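(* Let $\mathscr{H}$ be a complex Hilbert space and let $A,B\in\mathbb{B}(\mathscr{H})$. Then $$\Vert A+B\Vert\leq 2\,w\left(\begin{bmatrix}0&A\\ B^*&0\end{bmatrix}\right)\leq\Vert A\Vert+\Vert B\Vert,$$ where the block matrix denotes an operator on $\mathscr{H}\oplus\mathscr{H}$.
   Context: $\mathbb{B}(\mathscr{H})$ is the $C^*$-algebra of bounded linear operators on the complex Hilbert space $\mathscr{H}$, and $\Vert\cdot\Vert$ is the operator norm. The numerical radius of a bounded operator $S$ on a complex Hilbert space $\mathscr{K}$ (here $\mathscr{K}=\mathscr{H}\oplus\mathscr{H}$, the Hilbert space direct sum) is $w(S)=\sup\{|\langle Sx,x\rangle| : x\in\mathscr{K},\ \Vert x\Vert=1\}$. *)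

theory Defs
  imports "HOL-Analysis.Analysis"
begin

text \<open>The inner product is linear in the first argument and conjugate-linear in the second.\<close>

class complex_inner = real_normed_vector +
  fixes scaleC :: "complex \<Rightarrow> 'a \<Rightarrow> 'a"  (infixr \<open>*\<^sub>C\<close> 75)
    and cinner :: "'a \<Rightarrow> 'a \<Rightarrow> complex"
  assumes scaleC_add_right: "c *\<^sub>C (x + y) = c *\<^sub>C x + c *\<^sub>C y"
    and scaleC_add_left: "(c + d) *\<^sub>C x = c *\<^sub>C x + d *\<^sub>C x"
    and scaleC_scaleC: "c *\<^sub>C d *\<^sub>C x = (c * d) *\<^sub>C x"
    and scaleR_scaleC: "scaleR r x = complex_of_real r *\<^sub>C x"
    and cinner_commute: "cinner x y = cnj (cinner y x)"
    and cinner_add_left: "cinner (x + y) z = cinner x z + cinner y z"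
    and cinner_scaleC_left: "cinner (c *\<^sub>C x) y = c * cinner x y"
    and cinner_self_nonneg: "0 \<le> Re (cinner x x)"
    and cinner_eq_zero_iff: "cinner x x = 0 \<longleftrightarrow> x = 0"
    and norm_eq_sqrt_cinner: "norm x = sqrt (Re (cinner x x))"

class chilbert_space = complex_inner + complete_space

text \<open>
  The Hilbert space direct sum is the product type; its norm, the square root of the sum of the
  squared norms, is inherited from the \<open>real_normed_vector\<close> instance.
\<close>

instantiation prod :: (complex_inner, complex_inner) complex_inner
begin

definition scaleC_prod :: "complex \<Rightarrow> 'a \<times> 'b \<Rightarrow> 'a \<times> 'b"
  where "scaleC_prod c p = (c *\<^sub>C fst p, c *\<^sub>C snd p)"

definition cinner_prod :: "'a \<times> 'b \<Rightarrow> 'a \<times> 'b \<Rightarrow> complex"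
  where "cinner_prod p q = cinner (fst p) (fst q) + cinner (snd p) (snd q)"

instance
proof
  fix c d :: complex and r :: real and x y z :: "'a \<times> 'b"
  show "c *\<^sub>C (x + y) = c *\<^sub>C x + c *\<^sub>C y"
    by (simp add: scaleC_prod_def scaleC_add_right)
  show "(c + d) *\<^sub>C x = c *\<^sub>C x + d *\<^sub>C x"
    by (simp add: scaleC_prod_def scaleC_add_left)
  show "c *\<^sub>C d *\<^sub>C x = (c * d) *\<^sub>C x"
    by (simp add: scaleC_prod_def scaleC_scaleC)
  show "scaleR r x = complex_of_real r *\<^sub>C x"
    by (simp add: scaleC_prod_def scaleR_prod_def scaleR_scaleC)
  show "cinner x y = cnj (cinner y x)"
    unfolding cinner_prod_def complex_cnj_add by (metis cinner_commute)
  show "cinner (x + y) z = cinner x z + cinner y z"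
    by (simp add: cinner_prod_def cinner_add_left)
  show "cinner (c *\<^sub>C x) y = c * cinner x y"
    by (simp add: cinner_prod_def scaleC_prod_def cinner_scaleC_left algebra_simps)
  show "0 \<le> Re (cinner x x)"
    by (simp add: cinner_prod_def cinner_self_nonneg)
  show "norm x = sqrt (Re (cinner x x))"
    by (simp add: norm_prod_def cinner_prod_def norm_eq_sqrt_cinner cinner_self_nonneg)
  show "cinner x x = 0 \<longleftrightarrow> x = 0"
  proof
    assume "cinner x x = 0"
    then have "Re (cinner (fst x) (fst x)) + Re (cinner (snd x) (snd x)) = 0"
      unfolding cinner_prod_def by (metis plus_complex.simps(1) zero_complex.simps(1))
    with cinner_self_nonneg[of "fst x"] cinner_self_nonneg[of "snd x"]
    have "norm (fst x) = 0" "norm (snd x) = 0"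
      unfolding norm_eq_sqrt_cinner by auto
    then show "x = 0"
      by (simp add: prod_eq_iff)
  next
    assume "x = 0"
    then show "cinner x x = 0"
      using cinner_eq_zero_iff[of "0::'a"] cinner_eq_zero_iff[of "0::'b"]
      by (simp add: cinner_prod_def)
  qed
qed

end

instance prod :: (chilbert_space, chilbert_space) chilbert_space ..

definition bounded_clinear :: "('a::complex_inner \<Rightarrow> 'b::complex_inner) \<Rightarrow> bool"
  where "bounded_clinear T \<longleftrightarrow> bounded_linear T \<and> (\<forall>c x. T (c *\<^sub>C x) = c *\<^sub>C T x)"

text \<open>For a bounded operator between Hilbert spaces such a map exists and is unique.\<close>

definition cadjoint :: "('a::chilbert_space \<Rightarrow> 'b::chilbert_space) \<Rightarrow> 'b \<Rightarrow> 'a"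
  where "cadjoint T = (THE S. \<forall>x y. cinner (T x) y = cinner x (S y))"

definition block_op ::
    "('a::complex_inner \<Rightarrow> 'c::complex_inner) \<Rightarrow> ('b::complex_inner \<Rightarrow> 'c) \<Rightarrow>
     ('a \<Rightarrow> 'd::complex_inner) \<Rightarrow> ('b \<Rightarrow> 'd) \<Rightarrow> 'a \<times> 'b \<Rightarrow> 'c \<times> 'd"
  where "block_op T11 T12 T21 T22 = (\<lambda>(x, y). (T11 x + T12 y, T21 x + T22 y))"

text \<open>
  The supremum is that of a set of nonnegative numbers. Inserting \<open>0\<close> matters only for the zero
  space, which has no unit vectors: \<open>Sup {}\<close> is unspecified on the reals, whereas the numerical
  radius is \<open>0\<close> there.
\<close>

definition numerical_radius :: "('a::complex_inner \<Rightarrow> 'a) \<Rightarrow> real"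
  where "numerical_radius S = Sup (insert 0 {cmod (cinner (S x) x) | x. norm x = 1})"

lemma numerical_radius_eq_SUP:
  fixes S :: "'a::complex_inner \<Rightarrow> 'a"
  assumes "bdd_above {cmod (cinner (S x) x) | x. norm x = 1}" and "\<exists>x::'a. norm x = 1"
  shows "numerical_radius S = (SUP x\<in>{x. norm x = 1}. cmod (cinner (S x) x))"
proof -
  let ?X = "{cmod (cinner (S x) x) | x. norm x = 1}"
  have ne: "?X \<noteq> {}"
    using assms(2) by auto
  then obtain a where "a \<in> ?X" by blast
  moreover from this have "0 \<le> a" by auto
  ultimately have "0 \<le> Sup ?X"
    using cSup_upper[OF _ assms(1)] order_trans by blast
  then have "Sup (insert 0 ?X) = Sup ?X"
    using cSup_insert[OF ne assms(1)] by (simp add: sup_max)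
  moreover have "?X = (\<lambda>x. cmod (cinner (S x) x)) ` {x. norm x = 1}" by auto
  ultimately show ?thesis
    by (simp add: numerical_radius_def)
qed

end

theory Submission imports Defs begin

text \<open>
  With \<open>S\<close> the block operator, \<open>\<langle>S (x, y), (x, y)\<rangle> = \<langle>A y, x\<rangle> + cnj \<langle>B y, x\<rangle>\<close>. Cauchy--Schwarz
  bounds this by \<open>(\<parallel>A\<parallel> + \<parallel>B\<parallel>) \<parallel>x\<parallel> \<parallel>y\<parallel>\<close>, and \<open>2 \<parallel>x\<parallel> \<parallel>y\<parallel> \<le> 1\<close> on the unit sphere. Conversely its real
  part is \<open>Re \<langle>(A + B) y, x\<rangle>\<close>; choosing \<open>x\<close> parallel to \<open>(A + B) y\<close> with \<open>\<parallel>x\<parallel> = \<parallel>y\<parallel>\<close> recovers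
  \<open>\<parallel>(A + B) y\<parallel> \<parallel>y\<parallel>\<close>, which is at most \<open>w(S) (\<parallel>x\<parallel>\<^sup>2 + \<parallel>y\<parallel>\<^sup>2)\<close>.
\<close>

section \<open>Inner product identities and Cauchy-Schwarz\<close>

lemma cinner_add_right: "cinner x (y + z) = cinner x y + cinner x z"
  by (metis cinner_add_left cinner_commute complex_cnj_add)

lemma cinner_scaleC_right: "cinner x (c *\<^sub>C y) = cnj c * cinner x y"
  by (metis cinner_commute cinner_scaleC_left complex_cnj_mult)

lemma cinner_scaleR_left: "cinner (r *\<^sub>R x) y = of_real r * cinner x y"
  by (simp add: scaleR_scaleC cinner_scaleC_left)

lemma cinner_scaleR_right: "cinner x (r *\<^sub>R y) = of_real r * cinner x y"
  by (simp add: scaleR_scaleC cinner_scaleC_right)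

lemma cinner_zero_right [simp]: "cinner x 0 = 0"
  using cinner_add_right[of x 0 0] by simp

lemma cinner_diff_right: "cinner x (y - z) = cinner x y - cinner x z"
  using cinner_add_right[of x "y - z" z] by simp

lemma Re_cinner_self: "Re (cinner x x) = (norm x)\<^sup>2"
  by (simp add: norm_eq_sqrt_cinner cinner_self_nonneg)

lemma cinner_self: "cinner x x = of_real ((norm x)\<^sup>2)"
proof -
  have "Im (cinner x x) = 0"
    using arg_cong[OF cinner_commute[of x x], of Im] by simp
  then show ?thesis
    by (simp add: complex_eq_iff Re_cinner_self)
qed

lemma Re_cinner_commute: "Re (cinner x y) = Re (cinner y x)"
  by (subst cinner_commute) simp

lemma norm_add_sq: "(norm (x + y))\<^sup>2 = (norm x)\<^sup>2 + (norm y)\<^sup>2 + 2 * Re (cinner x y)"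
  for x y :: "'a::complex_inner"
  using Re_cinner_commute[of x y]
  by (simp add: Re_cinner_self[symmetric] cinner_add_left cinner_add_right)

lemma parallelogram_law:
  "(norm (x + y))\<^sup>2 + (norm (x - y))\<^sup>2 = 2 * (norm x)\<^sup>2 + 2 * (norm y)\<^sup>2"
  for x y :: "'a::complex_inner"
  using norm_add_sq[of x y] norm_add_sq[of x "-1 *\<^sub>R y"]
  by (simp only: cinner_scaleR_right) simp

text \<open>The class axioms give homogeneity of the norm for real scalars only; for complex ones it
  comes from the inner product, where the two arguments contribute \<open>c\<close> and
  \<open>cnj c\<close>.\<close>

lemma norm_scaleC: "norm (c *\<^sub>C x) = cmod c * norm x"
proof -
  have "(norm (c *\<^sub>C x))\<^sup>2 = (cmod c * norm x)\<^sup>2"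
  proof -
    have "cinner (c *\<^sub>C x) (c *\<^sub>C x) = (c * cnj c) * cinner x x"
      by (simp only: cinner_scaleC_left cinner_scaleC_right mult_ac)
    also have "\<dots> = of_real ((cmod c)\<^sup>2 * (norm x)\<^sup>2)"
      by (simp only: cinner_self complex_norm_square[symmetric] of_real_mult)
    finally show ?thesis
      by (metis Re_cinner_self Re_complex_of_real power_mult_distrib)
  qed
  then show ?thesis
    by (simp add: power2_eq_iff_nonneg)
qed

text \<open>The triangle inequality is already an axiom of normed spaces; squaring it and cancelling
  the squared norms leaves the real part of Cauchy-Schwarz.\<close>

lemma Re_cinner_le: "Re (cinner x y) \<le> norm x * norm y"
proof -
  have "(norm (x + y))\<^sup>2 \<le> (norm x + norm y)\<^sup>2"
    by (simp add: norm_triangle_ineq power_mono)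
  then show ?thesis
    by (simp add: norm_add_sq power2_sum)
qed

lemma cauchy_schwarz_cinner: "cmod (cinner x y) \<le> norm x * norm y"
proof (cases "cinner x y = 0")
  case False
  \<comment> \<open>A unimodular factor that rotates the inner product onto the nonnegative real
    axis, where the bound on real parts applies.\<close>
  define c where "c = cnj (sgn (cinner x y))"
  have "c * cinner x y = cmod (cinner x y)"
    using False by (simp add: c_def sgn_eq complex_norm_square[symmetric] power2_eq_square
        mult.commute)
  then have "cmod (cinner x y) = Re (cinner (c *\<^sub>C x) y)"
    by (simp add: cinner_scaleC_left)
  also have "\<dots> \<le> norm (c *\<^sub>C x) * norm y"
    by (rule Re_cinner_le)
  also have "norm (c *\<^sub>C x) = norm x"
    using False by (simp add: norm_scaleC c_def norm_sgn)
  finally show ?thesis .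
qed simp

section \<open>Riesz representation\<close>

text \<open>The polynomial attains its minimum 0 at \<open>t = 0\<close>, so its derivative
  \<open>b\<close> there vanishes.\<close>

lemma linear_coeff_eq_0:
  fixes a b :: real
  assumes "\<And>t. 0 \<le> a * t\<^sup>2 + b * t"
  shows "b = 0"
proof -
  \<comment> \<open>For this \<open>t\<close> the linear term is
    \<open>- (\<bar>a\<bar> + 1) * t\<^sup>2\<close>, which outweighs the quadratic one for either
    sign of \<open>a\<close>; the 1 keeps the denominator positive.\<close>
  have "a * t\<^sup>2 + b * t < 0" if "b \<noteq> 0" "t = - b / (\<bar>a\<bar> + 1)" for t
  proof -
    have "b = - t * (\<bar>a\<bar> + 1)" and "t \<noteq> 0"
      using that by (auto simp: field_simps)
    then have "b * t = - t * (\<bar>a\<bar> + 1) * t"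
      by metis
    then have "a * t\<^sup>2 + b * t = (a - \<bar>a\<bar> - 1) * t\<^sup>2"
      by (simp add: power2_eq_square algebra_simps)
    also have "\<dots> < 0"
      using \<open>t \<noteq> 0\<close> by (intro mult_neg_pos) auto
    finally show ?thesis .
  qed
  then show ?thesis
    using assms not_less by blast
qed

text \<open>
  The representing vector is the minimiser of \<open>\<phi> x = \<parallel>x\<parallel>\<^sup>2 - 2 g x\<close>: by the parallelogram law every
  minimising sequence is Cauchy, and the first variation of \<open>\<phi>\<close> vanishes at the limit.
\<close>

lemma real_riesz_representation:
  fixes g :: "'a::chilbert_space \<Rightarrow> real"
  assumes "bounded_linear g"
  shows "\<exists>y. \<forall>x. g x = Re (cinner x y)"
proof -
  interpret g: bounded_linear g by fact
  define \<phi> where "\<phi> x = (norm x)\<^sup>2 - 2 * g x" for x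
  obtain K where K: "\<And>x. \<bar>g x\<bar> \<le> norm x * K"
    using g.bounded by auto
  \<comment> \<open>Completing the square: \<open>\<phi> x + K\<^sup>2\<close> is at least
    \<open>(norm x - K)\<^sup>2\<close>.\<close>
  have "- K\<^sup>2 \<le> \<phi> x" for x
    using K[of x] zero_le_power2[of "norm x - K"]
    unfolding \<phi>_def power2_diff by (simp add: abs_le_iff)
  then have bdd: "bdd_below (range \<phi>)"
    by (rule bdd_belowI2)
  define m where "m = Inf (range \<phi>)"
  have m_le: "m \<le> \<phi> x" for x
    unfolding m_def by (rule cInf_lower[OF rangeI bdd])
  have "\<exists>x. \<phi> x < m + inverse (real (Suc n))" for n
    using cInf_lessD[of "range \<phi>" "m + inverse (real (Suc n))"] by (auto simp: m_def)
  then obtain X where X: "\<And>n. \<phi> (X n) < m + inverse (real (Suc n))"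
    by metis
  have dist_X: "(norm (x - z))\<^sup>2 \<le> 2 * (\<phi> x - m) + 2 * (\<phi> z - m)" for x z
  proof -
    \<comment> \<open>At the midpoint \<phi> is still at least \<open>m\<close>, so the
      parallelogram law bounds the distance by how far \<phi> exceeds \<open>m\<close> at
      \<open>x\<close> and \<open>z\<close>.\<close>
    define w where "w = (1/2) *\<^sub>R (x + z)"
    have "4 * \<phi> w = (norm (x + z))\<^sup>2 - 4 * (g x + g z)"
      by (simp add: w_def \<phi>_def g.scaleR g.add power_divide add_divide_distrib)
    moreover have "2 * \<phi> x + 2 * \<phi> z = 2 * (norm x)\<^sup>2 + 2 * (norm z)\<^sup>2 - 4 * (g x + g z)"
      by (simp add: \<phi>_def)
    ultimately show ?thesis
      using m_le[of w] parallelogram_law[of x z] by (simp add: algebra_simps)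
  qed
  have "Cauchy X"
  proof (rule metric_CauchyI)
    fix e :: real assume "0 < e"
    then obtain N where N: "inverse (real (Suc N)) < e\<^sup>2 / 4"
      using reals_Archimedean[of "e\<^sup>2 / 4"] by auto
    have close: "\<phi> (X n) - m < e\<^sup>2 / 4" if "N \<le> n" for n
    proof -
      have "inverse (real (Suc n)) \<le> inverse (real (Suc N))"
        using that by (intro le_imp_inverse_le) auto
      then show ?thesis
        using X[of n] N by linarith
    qed
    have "dist (X i) (X j) < e" if "N \<le> i" "N \<le> j" for i j
    proof -
      have "(norm (X i - X j))\<^sup>2 < e\<^sup>2"
        using dist_X[of "X i" "X j"] close[OF that(1)] close[OF that(2)] by (simp add: algebra_simps)
      then show ?thesis
        using \<open>0 < e\<close> by (simp add: dist_norm power_less_imp_less_base)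
    qed
    then show "\<exists>N. \<forall>i\<ge>N. \<forall>j\<ge>N. dist (X i) (X j) < e"
      by blast
  qed
  then obtain y where y: "X \<longlonglongrightarrow> y"
    using Cauchy_convergent_iff convergent_def by blast
  have "(\<lambda>n. \<phi> (X n)) \<longlonglongrightarrow> \<phi> y"
    unfolding \<phi>_def by (intro tendsto_intros g.tendsto y)
  moreover have "(\<lambda>n. m + inverse (real (Suc n))) \<longlonglongrightarrow> m + 0"
    by (intro tendsto_intros LIMSEQ_inverse_real_of_nat)
  ultimately have "\<phi> y \<le> m"
    using X by (intro LIMSEQ_le[of "\<lambda>n. \<phi> (X n)"]) (auto intro: less_imp_le)
  then have min: "\<phi> y \<le> \<phi> x" for x
    using m_le order_trans by blast
  have "g x = Re (cinner x y)" for x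
  proof -
    have "0 \<le> (norm x)\<^sup>2 * t\<^sup>2 + 2 * (Re (cinner x y) - g x) * t" for t
      using min[of "y + t *\<^sub>R x"] Re_cinner_commute[of x y]
      by (simp add: \<phi>_def norm_add_sq cinner_scaleR_right g.add g.scaleR power_mult_distrib
          algebra_simps)
    from linear_coeff_eq_0[OF this] show ?thesis
      by simp
  qed
  then show ?thesis
    by blast
qed

lemma riesz_representation:
  fixes f :: "'a::chilbert_space \<Rightarrow> complex"
  assumes "bounded_linear f" and scaleC: "\<And>c x. f (c *\<^sub>C x) = c * f x"
  shows "\<exists>y. \<forall>x. f x = cinner x y"
proof -
  have "bounded_linear (\<lambda>x. Re (f x))"
    by (rule bounded_linear_compose[OF bounded_linear_Re assms(1)])
  then obtain y where y: "\<And>x. Re (f x) = Re (cinner x y)"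
    using real_riesz_representation by blast
  \<comment> \<open>A complex-linear functional is determined by its real part, since multiplying
    the argument by \<i> turns the imaginary part into minus a real part.\<close>
  have "Im (f x) = Im (cinner x y)" for x
    using y[of "\<i> *\<^sub>C x"] by (simp add: scaleC cinner_scaleC_left)
  then show ?thesis
    using y by (auto simp: complex_eq_iff)
qed

section \<open>The adjoint\<close>

lemma cinner_right_ext:
  assumes "\<And>x. cinner x y = cinner x z"
  shows "y = z"
proof -
  have "cinner (y - z) (y - z) = 0"
    by (simp add: cinner_diff_right assms)
  then show ?thesis
    by (simp add: cinner_eq_zero_iff)
qed

text \<open>Riesz gives a representing vector for each \<open>y\<close>, and testing against all
  vectors makes it unique, so the definite description in \<open>cadjoint\<close> denotes.\<close>

lemma cinner_cadjoint:
  fixes T :: "'a::chilbert_space \<Rightarrow> 'b::chilbert_space"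
  assumes "bounded_clinear T"
  shows "cinner (T x) y = cinner x (cadjoint T y)"
proof -
  interpret T: bounded_linear T
    using assms by (simp add: bounded_clinear_def)
  have T_scaleC: "T (c *\<^sub>C x) = c *\<^sub>C T x" for c x
    using assms by (simp add: bounded_clinear_def)
  obtain K where K: "\<And>x. norm (T x) \<le> norm x * K"
    using T.bounded by auto
  have "\<exists>z. \<forall>x. cinner (T x) y = cinner x z" for y
  proof (rule riesz_representation)
    show "bounded_linear (\<lambda>x. cinner (T x) y)"
    proof (rule bounded_linear_intro)
      fix x x' r
      show "cinner (T (x + x')) y = cinner (T x) y + cinner (T x') y"
        by (simp add: T.add cinner_add_left)
      show "cinner (T (r *\<^sub>R x)) y = r *\<^sub>R cinner (T x) y"
        by (simp add: T.scaleR cinner_scaleR_left scaleR_conv_of_real)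
      have "cmod (cinner (T x) y) \<le> norm (T x) * norm y"
        by (rule cauchy_schwarz_cinner)
      also have "\<dots> \<le> norm x * K * norm y"
        by (intro mult_right_mono K) simp
      finally show "cmod (cinner (T x) y) \<le> norm x * (K * norm y)"
        by (simp add: mult.assoc)
    qed
    show "cinner (T (c *\<^sub>C x)) y = c * cinner (T x) y" for c x
      by (simp add: T_scaleC cinner_scaleC_left)
  qed
  then obtain S where S: "\<forall>x y. cinner (T x) y = cinner x (S y)"
    by metis
  have "cadjoint T = S"
    unfolding cadjoint_def
  proof (rule the_equality)
    show "R = S" if "\<forall>x y. cinner (T x) y = cinner x (R y)" for R
      using that S by (intro ext cinner_right_ext) metis
  qed (rule S)
  then show ?thesis
    using S by simp
qed

text \<open>The adjoint sits in the first argument, so moving it across conjugates the second term.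
  The real parts of both terms therefore add up to that of \<open>A + B\<close>.\<close>

lemma cinner_off_diagonal_block_op:
  fixes A B :: "'a::chilbert_space \<Rightarrow> 'b::chilbert_space"
  assumes "bounded_clinear B"
  shows "cinner (block_op (\<lambda>_. 0) A (cadjoint B) (\<lambda>_. 0) (x, y)) (x, y)
           = cinner (A y) x + cnj (cinner (B y) x)"
  using cinner_cadjoint[OF assms, of y x] cinner_commute[of "cadjoint B x" y]
  by (simp add: block_op_def cinner_prod_def)

section \<open>Numerical radius\<close>

text \<open>The hypothesis \<open>0 \<le> b\<close> accounts for the inserted 0 in the
  supremum.\<close>

lemma numerical_radius_le:
  assumes "0 \<le> b" and "\<And>x. norm x = 1 \<Longrightarrow> cmod (cinner (S x) x) \<le> b"
  shows "numerical_radius S \<le> b"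
  unfolding numerical_radius_def using assms by (intro cSup_least) auto

lemma numerical_radius_nonneg:
  assumes "bdd_above {cmod (cinner (S x) x) | x. norm x = 1}"
  shows "0 \<le> numerical_radius S"
  unfolding numerical_radius_def using assms by (intro cSup_upper) auto

text \<open>The quadratic form has degree two under real scaling, so a nonzero \<open>x\<close>
  reduces to its normalisation \<open>u\<close>.\<close>

lemma cmod_cinner_le_numerical_radius:
  assumes "bdd_above {cmod (cinner (S x) x) | x. norm x = 1}"
    and scaleR: "\<And>r x. S (r *\<^sub>R x) = r *\<^sub>R S x"
  shows "cmod (cinner (S x) x) \<le> numerical_radius S * (norm x)\<^sup>2"
proof (cases "x = 0")
  case False
  define u where "u = inverse (norm x) *\<^sub>R x"
  have x: "x = norm x *\<^sub>R u" and "norm u = 1"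
    using False by (simp_all add: u_def)
  then have "cmod (cinner (S u) u) \<le> numerical_radius S"
    unfolding numerical_radius_def using assms(1) by (intro cSup_upper) auto
  moreover have "cinner (S x) x = of_real ((norm x)\<^sup>2) * cinner (S u) u"
    by (subst (1 2) x)
      (simp add: scaleR cinner_scaleR_left cinner_scaleR_right power2_eq_square)
  then have "cmod (cinner (S x) x) = (norm x)\<^sup>2 * cmod (cinner (S u) u)"
    by (simp add: norm_mult norm_power)
  ultimately show ?thesis
    by (simp add: mult.commute[of "(norm x)\<^sup>2"] mult_right_mono)
qed simp

theorem theorem2p3:
  fixes A B :: "'h::chilbert_space \<Rightarrow> 'h"
  assumes "bounded_clinear A" and "bounded_clinear B"
  shows "onorm (\<lambda>x. A x + B x)
           \<le> 2 * numerical_radius (block_op (\<lambda>_. 0) A (cadjoint B) (\<lambda>_. 0))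
       \<and> 2 * numerical_radius (block_op (\<lambda>_. 0) A (cadjoint B) (\<lambda>_. 0))
           \<le> onorm A + onorm B"
proof -
  have A: "bounded_linear A" and B: "bounded_linear B"
    using assms by (simp_all add: bounded_clinear_def)
  define S where "S = block_op (\<lambda>_. 0) A (cadjoint B) (\<lambda>_. 0)"
  have S: "cinner (S (x, y)) (x, y) = cinner (A y) x + cnj (cinner (B y) x)" for x y
    unfolding S_def by (rule cinner_off_diagonal_block_op[OF assms(2)])
  have upper: "cmod (cinner (S p) p) \<le> (onorm A + onorm B) / 2" if "norm p = 1" for p
  proof -
    obtain x y where p: "p = (x, y)"
      by (cases p)
    have sq: "(norm x)\<^sup>2 + (norm y)\<^sup>2 = 1"
      using that unfolding p norm_Pair by simp
    have term_le: "cmod (cinner (T y) x) \<le> onorm T * (norm x * norm y)"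
      if "bounded_linear T" for T :: "'h \<Rightarrow> 'h"
    proof -
      have "cmod (cinner (T y) x) \<le> norm (T y) * norm x"
        by (rule cauchy_schwarz_cinner)
      also have "\<dots> \<le> onorm T * norm y * norm x"
        by (intro mult_right_mono onorm that) simp
      finally show ?thesis
        by (simp add: mult_ac)
    qed
    have "cmod (cinner (S p) p) \<le> cmod (cinner (A y) x) + cmod (cinner (B y) x)"
      unfolding p S by (metis complex_mod_cnj norm_triangle_ineq)
    also have "\<dots> \<le> (onorm A + onorm B) * (norm x * norm y)"
      using term_le[OF A] term_le[OF B] by (simp add: distrib_right)
    also have "\<dots> \<le> (onorm A + onorm B) * (1 / 2)"
      using sum_squares_bound[of "norm x" "norm y"] sq onorm_pos_le[OF A] onorm_pos_le[OF B]
      by (intro mult_left_mono) (auto simp: mult.assoc)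
    finally show ?thesis
      by simp
  qed
  \<comment> \<open>The upper estimate also provides the boundedness without which the supremum need
    not be an upper bound.\<close>
  then have bdd: "bdd_above {cmod (cinner (S p) p) | p. norm p = 1}"
    by (intro bdd_aboveI[where M = "(onorm A + onorm B) / 2"]) blast
  \<comment> \<open>Homogeneity of the adjoint is read off from its defining identity; a real
    \<open>r\<close> leaves the second argument unconjugated.\<close>
  have cadjoint_scaleR: "cadjoint B (r *\<^sub>R y) = r *\<^sub>R cadjoint B y" for r y
    by (rule cinner_right_ext)
      (simp add: cinner_cadjoint[OF assms(2), symmetric] cinner_scaleR_right)
  have S_scaleR: "S (r *\<^sub>R p) = r *\<^sub>R S p" for r p
    by (cases p) (simp add: S_def block_op_def cadjoint_scaleR linear_simps(5)[OF A])
  have "onorm (\<lambda>x. A x + B x) \<le> 2 * numerical_radius S"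
  proof (rule onorm_bound)
    show "0 \<le> 2 * numerical_radius S"
      using numerical_radius_nonneg[OF bdd] by simp
    fix y
    define z where "z = A y + B y"
    show "norm (A y + B y) \<le> 2 * numerical_radius S * norm y"
    \<comment> \<open>The main case divides by \<open>norm z\<close> to build \<open>x\<close> and
      cancels \<open>norm y\<close> at the end; here the left-hand side is 0.\<close>
    proof (cases "z = 0 \<or> y = 0")
      case True
      then show ?thesis
        using numerical_radius_nonneg[OF bdd] A B
        by (auto simp: z_def linear_simps)
    next
      case False
      define x where "x = (norm y / norm z) *\<^sub>R z"
      have norm_x: "norm x = norm y"
        using False by (simp add: x_def)
      have "norm z * norm y = Re (cinner z x)"
        using False by (simp add: x_def cinner_scaleR_right Re_cinner_self power2_eq_square)
      also have "\<dots> = Re (cinner (S (x, y)) (x, y))"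
        by (simp add: S z_def cinner_add_left)
      also have "\<dots> \<le> cmod (cinner (S (x, y)) (x, y))"
        by (rule complex_Re_le_cmod)
      also have "\<dots> \<le> numerical_radius S * (norm (x, y))\<^sup>2"
        by (rule cmod_cinner_le_numerical_radius[OF bdd S_scaleR])
      \<comment> \<open>The factor 2 arises because both components of \<open>(x, y)\<close> have
        norm \<open>norm y\<close>.\<close>
      also have "\<dots> = 2 * numerical_radius S * norm y * norm y"
        by (simp add: norm_Pair norm_x power2_eq_square)
      finally show ?thesis
        using False by (simp add: z_def)
    qed
  qed
  moreover have "2 * numerical_radius S \<le> onorm A + onorm B"
    using numerical_radius_le[of "(onorm A + onorm B) / 2" S] upper
      onorm_pos_le[OF A] onorm_pos_le[OF B] by simp
  ultimately show ?thesis
    by (simp add: S_def)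
qed

end
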